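(* For any sequence $(\theta_k)$ in $(0,1)$ with $\theta_k\to1^-$, any $x\in\ell_\infty$ and any free ultrafilter $\mathcal F$ on $\mathbb N$, $$t(x)=\sup_{\mathcal G\in\beta\mathbb N^*}\ \mathcal F\text{-}\lim_k\ \mathcal G\text{-}\lim_n\ \Theta_{\theta_k,n}(x).$$
   Context: For $\theta\in(0,1)$, $n\in\mathbb N$ and bounded $x$, $\Theta_{\theta,n}(x)=\frac{\sum_i x_i\chi_{(\theta n,n]}(i)}{n(1-\theta)}$, and $t(x)=\lim_{\theta\to1^-}\limsup_{n\to\infty}\Theta_{\theta,n}(x)$ (this limit exists). For an ultrafilter $\mathcal F$ on $\mathbb N$ and a bounded real sequence $(y_n)$, $\mathcal F\text{-}\lim y_n$ is the unique $L\in\mathbb R$ with $\{n:|y_n-L|<\varepsilon\}\in\mathcal F$ for every $\varepsilon>0$. $\beta\mathbb N^*$ is the set of all free (non-principal) ultrafilters on $\mathbb N$. *)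

theory Defs
  imports "HOL-Analysis.Analysis"
begin

text \<open>
  A set filter on \<open>\<nat>\<close> is rendered by the library type \<^typ>\<open>nat filter\<close>: the set \<open>{n. P n}\<close> belongs
  to \<open>F\<close> iff \<open>eventually P F\<close>. The type also contains the improper filter \<^term>\<open>bot\<close>, which has to
  be excluded. The limit of \<open>y\<close> along \<open>F\<close> is the library's \<open>Lim F y\<close>, i.e. the unique \<open>L\<close> with
  \<open>eventually (\<lambda>n. dist (y n) L < e) F\<close> for all \<open>e > 0\<close>.
\<close>

definition ultrafilter :: "'a filter \<Rightarrow> bool" where
  "ultrafilter F \<longleftrightarrow> F \<noteq> bot \<and> (\<forall>P. eventually P F \<or> eventually (\<lambda>a. \<not> P a) F)"

definition free_ultrafilters :: "nat filter set" where
  "free_ultrafilters = {F. ultrafilter F \<and> \<not> (\<exists>n. F = principal {n})}"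

text \<open>
  The number \<open>x 0\<close> never enters the sum, so \<open>x\<close> stands for the sequence \<open>x 1, x 2, \<dots>\<close>. At \<open>n = 0\<close>
  the value is \<open>0\<close> by the convention on division; this affects neither the upper limit in \<open>n\<close> nor
  a limit along a free ultrafilter.
\<close>

definition Theta :: "real \<Rightarrow> nat \<Rightarrow> (nat \<Rightarrow> real) \<Rightarrow> real" where
  "Theta \<theta> n x = (\<Sum>i | real i \<in> {\<theta> * real n <.. real n}. x i) / (real n * (1 - \<theta>))"

text \<open>
  \<^term>\<open>limsup\<close> needs a complete lattice, hence the passage through \<^typ>\<open>ereal\<close>; for bounded \<open>x\<close>
  and \<open>\<theta>\<close> in \<open>(0,1)\<close> the upper limit is finite.
\<close>

definition t_func :: "(nat \<Rightarrow> real) \<Rightarrow> real" where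
  "t_func x = Lim (at_left 1) (\<lambda>\<theta>. real_of_ereal (limsup (\<lambda>n. ereal (Theta \<theta> n x))))"

end

theory Submission
  imports Defs
begin

text \<open>
  Let \<open>T \<theta>\<close> be the upper limit of the averages over the windows \<open>(\<theta> n, n]\<close>. If \<open>s < T \<theta>\<close> for a
  single \<open>\<theta>\<close>, then for some \<open>c > 0\<close> there are infinitely many \<open>n\<close> for which all windows
  \<open>(\<phi> n, n]\<close> with \<open>1 - c \<le> \<phi> < 1\<close> have average at least \<open>s\<close> simultaneously. Hence \<open>T\<close> tends to
  its supremum at \<open>1\<close>, and a free ultrafilter containing these \<open>n\<close> has limits at least \<open>s\<close> for
  all \<open>\<phi>\<close> close to \<open>1\<close>, which gives the lower bound for every \<open>F\<close>.
\<close>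

section \<open>Ultrafilters: existence, limits and freeness\<close>

text \<open>Zorn's lemma for the reversed order: a finer filter is a smaller one, so ultrafilters
  are the minimal proper filters.\<close>

lemma ex_ultrafilter_le:
  assumes "F0 \<noteq> bot"
  obtains F where "F \<le> F0" "ultrafilter F"
proof -
  define A where "A = {F. F \<noteq> bot \<and> F \<le> F0}"
  have "\<exists>m\<in>A. \<forall>a\<in>A. a \<le> m \<longrightarrow> a = m"
  proof (rule predicate_Zorn)
    show "partial_order_on A (relation_of (\<lambda>F G. G \<le> F) A)"
      by (auto simp: partial_order_on_def preorder_on_def refl_on_def trans_def antisym_def relation_of_def)
    fix C assume "C \<in> Chains (relation_of (\<lambda>F G. G \<le> F) A)"
    then have C: "C \<subseteq> A" "\<And>a b. a \<in> C \<Longrightarrow> b \<in> C \<Longrightarrow> a \<le> b \<or> b \<le> a"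
      by (auto simp: Chains_def relation_of_def)
    show "\<exists>u\<in>A. \<forall>a\<in>C. u \<le> a"
    \<comment> \<open>The empty chain has infimum \<open>top\<close>, which need not lie below
      \<open>F0\<close>.\<close>
    proof (cases "C = {}")
      case True
      then show ?thesis using assms by (auto simp: A_def)
    next
      case False
      \<comment> \<open>A chain is directed downwards, so its members form a base of
        \<open>Inf C\<close>, which is therefore proper.\<close>
      have "eventually P (Inf C) \<longleftrightarrow> (\<exists>b\<in>C. eventually P b)" for P
      proof (rule eventually_Inf_base[OF False])
        show "\<exists>c\<in>C. c \<le> inf a b" if "a \<in> C" "b \<in> C" for a b
          using C(2)[OF that] that by (metis inf.orderE inf.cobounded1 inf_commute order_refl)
      qed
      then have "Inf C \<noteq> bot"
        using C(1) by (auto simp: trivial_limit_def A_def)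
      moreover have "Inf C \<le> F0"
        using False C(1) by (auto simp: A_def intro: Inf_lower2)
      ultimately show ?thesis
        by (intro bexI[of _ "Inf C"]) (auto simp: A_def Inf_lower)
    qed
  qed
  then obtain F where F: "F \<noteq> bot" "F \<le> F0"
    and min: "\<And>G. G \<noteq> bot \<Longrightarrow> G \<le> F0 \<Longrightarrow> G \<le> F \<Longrightarrow> G = F"
    by (auto simp: A_def)
  \<comment> \<open>Restrict \<open>F\<close> to \<open>P\<close>: the trace is either improper, so
    that \<open>P\<close> fails eventually, or equal to \<open>F\<close> by minimality.\<close>
  have "eventually P F \<or> eventually (\<lambda>a. \<not> P a) F" for P
  proof (cases "inf F (principal {a. P a}) = bot")
    case True
    then show ?thesis
      by (auto simp: trivial_limit_def eventually_inf_principal)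
  next
    case False
    then have "inf F (principal {a. P a}) = F"
      using F(2) by (intro min) (auto intro: le_infI1)
    moreover have "eventually P (inf F (principal {a. P a}))"
      by (simp add: eventually_inf_principal)
    ultimately show ?thesis by simp
  qed
  with F that show ?thesis by (auto simp: ultrafilter_def)
qed

text \<open>Compactness gives the image filter a cluster point in \<open>K\<close>. It is a limit,
  because an ultrafilter that misses the preimage of a neighbourhood contains its
  complement.\<close>

lemma ultrafilter_tendsto_compact:
  fixes f :: "'a \<Rightarrow> 'b::topological_space"
  assumes F: "ultrafilter F" and K: "compact K" and ev: "eventually (\<lambda>a. f a \<in> K) F"
  obtains l where "l \<in> K" "(f \<longlongrightarrow> l) F"
proof -
  have "filtermap f F \<noteq> bot" "eventually (\<lambda>y. y \<in> K) (filtermap f F)"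
    using F ev by (auto simp: ultrafilter_def filtermap_bot_iff eventually_filtermap)
  with K obtain l where l: "l \<in> K" "inf (nhds l) (filtermap f F) \<noteq> bot"
    unfolding compact_filter by blast
  have "eventually (\<lambda>a. f a \<in> S) F" if "open S" "l \<in> S" for S
  proof (rule ccontr)
    assume "\<not> eventually (\<lambda>a. f a \<in> S) F"
    then have "eventually (\<lambda>y. y \<notin> S) (filtermap f F)"
      using F by (auto simp: ultrafilter_def eventually_filtermap)
    moreover have "eventually (\<lambda>y. y \<in> S) (nhds l)"
      using that by (rule eventually_nhds_in_open)
    ultimately have "eventually (\<lambda>y. False) (inf (nhds l) (filtermap f F))"
      unfolding eventually_inf by blast
    with l(2) show False by (simp add: trivial_limit_def)
  qed
  with l(1) that show ?thesis by (auto intro: topological_tendstoI)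
qed

text \<open>\<open>Lim\<close> is a definite description; boundedness along an ultrafilter makes it
  a true limit.\<close>

lemma ultrafilter_Lim_bounded:
  fixes f :: "'a \<Rightarrow> real"
  assumes "ultrafilter F" and "eventually (\<lambda>a. \<bar>f a\<bar> \<le> B) F"
  shows "(f \<longlongrightarrow> Lim F f) F" and "\<bar>Lim F f\<bar> \<le> B"
proof -
  have "eventually (\<lambda>a. f a \<in> {-B..B}) F"
    using assms(2) by (rule eventually_mono) auto
  from ultrafilter_tendsto_compact[OF assms(1) compact_Icc this]
  obtain l where l: "l \<in> {-B..B}" "(f \<longlongrightarrow> l) F" .
  then have "Lim F f = l"
    using assms(1) by (auto simp: ultrafilter_def intro: tendsto_Lim)
  with l show "(f \<longlongrightarrow> Lim F f) F" and "\<bar>Lim F f\<bar> \<le> B" by auto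
qed

text \<open>An ultrafilter containing \<open>{n}\<close> is principal, so a free one omits all
  finite sets. What holds for all large indices thus passes to every free ultrafilter.\<close>

lemma free_ultrafilters_iff:
  "G \<in> free_ultrafilters \<longleftrightarrow> ultrafilter G \<and> G \<le> sequentially"
proof (intro iffI conjI)
  assume "G \<in> free_ultrafilters"
  then have G: "ultrafilter G" "\<And>n. G \<noteq> principal {n}"
    by (auto simp: free_ultrafilters_def)
  then show "ultrafilter G" by simp
  have ne: "eventually (\<lambda>a. a \<noteq> n) G" for n
  proof (rule ccontr)
    assume "\<not> eventually (\<lambda>a. a \<noteq> n) G"
    then have n: "eventually (\<lambda>a. a = n) G"
      using G(1) by (auto simp: ultrafilter_def)
    have "P n" if "eventually P G" for P
    proof -
      have "eventually (\<lambda>a. P n) G"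
        using that n by eventually_elim simp
      then show ?thesis using G(1) by (auto simp: ultrafilter_def eventually_const)
    qed
    moreover have "eventually P G" if "P n" for P
      using n by eventually_elim (use that in simp)
    ultimately have "G = principal {n}"
      by (auto simp: filter_eq_iff eventually_principal)
    with G(2) show False by blast
  qed
  have "eventually (\<lambda>a. n \<le> a) G" for n
  proof -
    have "eventually (\<lambda>a. \<forall>i\<in>{..<n}. a \<noteq> i) G"
      by (intro eventually_ball_finite) (auto intro: ne)
    then show ?thesis
      by (rule eventually_mono) (use linorder_not_less in auto)
  qed
  then show "G \<le> sequentially"
    unfolding le_filter_def eventually_sequentially by (blast intro: eventually_mono)
next
  assume *: "ultrafilter G \<and> G \<le> sequentially"
  have "G \<noteq> principal {n}" for n
  proof
    assume "G = principal {n}"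
    moreover have "eventually (\<lambda>a. n < a) G"
      using * by (blast intro: filter_leD eventually_gt_at_top)
    ultimately show False by (simp add: eventually_principal)
  qed
  with * show "G \<in> free_ultrafilters" by (auto simp: free_ultrafilters_def)
qed

lemma ex_free_ultrafilter_frequently:
  assumes "\<And>K. \<exists>n\<ge>K. P (n::nat)"
  obtains G where "G \<in> free_ultrafilters" "eventually P G"
proof -
  have "inf sequentially (principal {n. P n}) \<noteq> bot"
    using assms by (fastforce simp: trivial_limit_def eventually_inf_principal eventually_sequentially)
  then obtain G where "G \<le> inf sequentially (principal {n. P n})" "ultrafilter G"
    by (rule ex_ultrafilter_le)
  with that[of G] show ?thesis by (simp add: free_ultrafilters_iff le_principal)
qed

section \<open>Averages over the windows (\<theta> n, n]\<close>

lemma Theta_eq: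
  assumes "0 \<le> \<theta>"
  shows "Theta \<theta> n x = sum x {nat \<lfloor>\<theta> * real n\<rfloor><..n} / (real n * (1 - \<theta>))"
proof -
  have "{i. real i \<in> {\<theta> * real n<..real n}} = {nat \<lfloor>\<theta> * real n\<rfloor><..n}"
    using assms by (auto simp: nat_less_iff floor_less_iff)
  then show ?thesis by (simp add: Theta_def)
qed

text \<open>The number of integers in the window exceeds its length n (1 - \<theta>) by at most 1,
  so dividing by the length instead of the count changes nothing in the limit.\<close>

lemma window_card_tendsto:
  assumes "0 < \<theta>" "\<theta> < (1::real)"
  shows "(\<lambda>n. real (n - nat \<lfloor>\<theta> * real n\<rfloor>) / (real n * (1 - \<theta>))) \<longlonglongrightarrow> 1"
proof (rule tendsto_sandwich)
  have *: "nat \<lfloor>\<theta> * real n\<rfloor> \<le> n" "real (nat \<lfloor>\<theta> * real n\<rfloor>) \<le> \<theta> * real n"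
    "\<theta> * real n - 1 \<le> real (nat \<lfloor>\<theta> * real n\<rfloor>)" for n
  proof -
    show "real (nat \<lfloor>\<theta> * real n\<rfloor>) \<le> \<theta> * real n"
      using assms by simp
    also have "\<dots> \<le> real n" using assms by (simp add: mult_left_le_one_le)
    finally show "nat \<lfloor>\<theta> * real n\<rfloor> \<le> n" by simp
    show "\<theta> * real n - 1 \<le> real (nat \<lfloor>\<theta> * real n\<rfloor>)" by linarith
  qed
  show "\<forall>\<^sub>F n in sequentially. 1 \<le> real (n - nat \<lfloor>\<theta> * real n\<rfloor>) / (real n * (1 - \<theta>))"
    using eventually_gt_at_top[of 0]
  proof eventually_elim
    case (elim n)
    then show ?case
      using assms *[of n] by (simp add: of_nat_diff le_divide_eq algebra_simps)
  qed
  show "\<forall>\<^sub>F n in sequentially. real (n - nat \<lfloor>\<theta> * real n\<rfloor>) / (real n * (1 - \<theta>))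
      \<le> 1 + inverse (real n) / (1 - \<theta>)"
    using eventually_gt_at_top[of 0]
  proof eventually_elim
    case (elim n)
    have "real (n - nat \<lfloor>\<theta> * real n\<rfloor>) / (real n * (1 - \<theta>)) \<le> (real n * (1 - \<theta>) + 1) / (real n * (1 - \<theta>))"
      using assms *[of n] by (intro divide_right_mono) (auto simp: of_nat_diff algebra_simps mult_left_le_one_le)
    also have "\<dots> = 1 + inverse (real n) / (1 - \<theta>)"
      using elim assms by (simp add: field_simps)
    finally show ?case .
  qed
  show "(\<lambda>n. 1 + inverse (real n) / (1 - \<theta>)) \<longlonglongrightarrow> 1"
    using tendsto_add[OF tendsto_const tendsto_divide[OF lim_inverse_n tendsto_const], of "1 - \<theta>" 1] assms
    by simp
qed simp

text \<open>The ratio of count to length can exceed 1, but is eventually below 2; hence the factor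
  in the bound.\<close>

lemma eventually_abs_Theta_le:
  assumes \<theta>: "0 < \<theta>" "\<theta> < 1" and M: "\<And>i. \<bar>x i\<bar> \<le> M"
  shows "eventually (\<lambda>n. \<bar>Theta \<theta> n x\<bar> \<le> 2 * M) sequentially"
proof -
  have "0 \<le> M" using M[of 0] by linarith
  have "eventually (\<lambda>n. real (n - nat \<lfloor>\<theta> * real n\<rfloor>) / (real n * (1 - \<theta>)) < 2) sequentially"
    using window_card_tendsto[OF \<theta>] by (rule order_tendstoD) simp
  then show ?thesis
  proof eventually_elim
    case (elim n)
    have "\<bar>sum x {nat \<lfloor>\<theta> * real n\<rfloor><..n}\<bar> \<le> (\<Sum>i\<in>{nat \<lfloor>\<theta> * real n\<rfloor><..n}. M)"
      using M by (intro order.trans[OF sum_abs] sum_mono)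
    then have "\<bar>Theta \<theta> n x\<bar> \<le> M * (real (n - nat \<lfloor>\<theta> * real n\<rfloor>) / (real n * (1 - \<theta>)))"
      using \<theta> divide_right_mono[of _ _ "real n * (1 - \<theta>)"]
      by (simp add: Theta_eq abs_mult mult.commute[of M])
    also have "\<dots> \<le> M * 2"
      using elim \<open>0 \<le> M\<close> by (intro mult_left_mono) auto
    finally show ?case by simp
  qed
qed

text \<open>The upper limit is finite, so \<open>real_of_ereal\<close> never meets an infinite
  value, which it would send to 0.\<close>

lemma limsup_Theta:
  assumes \<theta>: "0 < \<theta>" "\<theta> < 1" and M: "\<And>i. \<bar>x i\<bar> \<le> M"
  shows "limsup (\<lambda>n. ereal (Theta \<theta> n x)) = ereal (real_of_ereal (limsup (\<lambda>n. ereal (Theta \<theta> n x))))"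
    and "real_of_ereal (limsup (\<lambda>n. ereal (Theta \<theta> n x))) \<le> 2 * M"
proof -
  let ?T = "limsup (\<lambda>n. ereal (Theta \<theta> n x))"
  note ev = eventually_abs_Theta_le[OF \<theta>, of x M, OF M]
  have "?T \<le> ereal (2 * M)"
    using ev by (intro Limsup_bounded) (auto elim: eventually_mono)
  moreover have "ereal (- (2 * M)) \<le> ?T"
    using ev by (intro le_Limsup) (auto elim: eventually_mono)
  ultimately show "?T = ereal (real_of_ereal ?T)" "real_of_ereal ?T \<le> 2 * M"
    by (cases ?T; simp)+
qed

text \<open>A free ultrafilter refines \<open>sequentially\<close>, so its limit cannot exceed the
  upper limit. The bound is uniform in \<theta>, which later makes the outer limit along
  \<open>F\<close> exist.\<close>

lemma Lim_Theta:
  assumes \<theta>: "0 < \<theta>" "\<theta> < 1" and M: "\<And>i. \<bar>x i\<bar> \<le> M" and G: "G \<in> free_ultrafilters"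
  shows "Lim G (\<lambda>n. Theta \<theta> n x) \<le> real_of_ereal (limsup (\<lambda>n. ereal (Theta \<theta> n x)))"
    and "((\<lambda>n. Theta \<theta> n x) \<longlongrightarrow> Lim G (\<lambda>n. Theta \<theta> n x)) G"
    and "\<bar>Lim G (\<lambda>n. Theta \<theta> n x)\<bar> \<le> 2 * M"
proof -
  let ?T = "real_of_ereal (limsup (\<lambda>n. ereal (Theta \<theta> n x)))"
  have G': "ultrafilter G" "G \<le> sequentially" "G \<noteq> bot"
    using G by (auto simp: free_ultrafilters_iff ultrafilter_def)
  have "eventually (\<lambda>n. \<bar>Theta \<theta> n x\<bar> \<le> 2 * M) G"
    using eventually_abs_Theta_le[OF \<theta> M] G'(2) by (rule filter_leD[rotated])
  note L = ultrafilter_Lim_bounded[OF G'(1) this]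
  show "((\<lambda>n. Theta \<theta> n x) \<longlongrightarrow> Lim G (\<lambda>n. Theta \<theta> n x)) G"
    and "\<bar>Lim G (\<lambda>n. Theta \<theta> n x)\<bar> \<le> 2 * M" by (fact L)+
  show "Lim G (\<lambda>n. Theta \<theta> n x) \<le> ?T"
  proof (rule dense_ge)
    fix r assume "?T < r"
    then have "limsup (\<lambda>n. ereal (Theta \<theta> n x)) < ereal r"
      by (subst limsup_Theta(1)[OF \<theta> M]) simp
    then have "eventually (\<lambda>n. ereal (Theta \<theta> n x) < ereal r) G"
      using Limsup_lessD filter_leD[OF G'(2)] by blast
    then show "Lim G (\<lambda>n. Theta \<theta> n x) \<le> r"
      by (intro tendsto_upperbound[OF L(1)]) (auto elim: eventually_mono simp: G'(3))
  qed
qed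

section \<open>A maximiser argument for simultaneous large averages\<close>

text \<open>
  A rising-sun argument: \<open>n\<close> is a maximiser of \<open>\<Sum>i\<le>n. x i - s\<close> over \<open>\<theta> N \<le> n \<le> N\<close>, so every
  window that ends at \<open>n\<close> and starts after \<open>\<theta> N\<close> has average at least \<open>s\<close>; since the sum
  increases by a multiple of \<open>N\<close>, the maximiser is far away from \<open>\<theta> N\<close>.
\<close>

lemma windows_with_large_average:
  assumes \<theta>: "0 < \<theta>" "\<theta> < 1" and M: "\<And>i. \<bar>x i\<bar> \<le> M"
    and s: "ereal s < limsup (\<lambda>n. ereal (Theta \<theta> n x))"
  obtains c where "0 < c" and "\<forall>K. \<exists>n\<ge>K. \<forall>\<phi>\<in>{1 - c..<1}.
    s * real (n - nat \<lfloor>\<phi> * real n\<rfloor>) \<le> sum x {nat \<lfloor>\<phi> * real n\<rfloor><..n}"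
proof -
  \<comment> \<open>The gap between \<open>s\<close> and \<open>s'\<close> yields a gain
    proportional to \<open>N\<close>.\<close>
  obtain s' where "ereal s < ereal s'" and s': "ereal s' < limsup (\<lambda>n. ereal (Theta \<theta> n x))"
    using ereal_dense2[OF s] by auto
  then have "s < s'" by simp
  \<comment> \<open>\<open>B\<close> exceeds every increment of the sum \<open>D\<close> below; the
    summand 1 keeps it positive.\<close>
  define B where "B = M + \<bar>s\<bar> + 1"
  have "0 \<le> M" using M[of 0] by linarith
  then have B: "0 < B" by (simp add: B_def)
  define a where "a = (s' - s) * (1 - \<theta>)"
  have a: "0 < a" using \<open>s < s'\<close> \<theta> by (simp add: a_def)
  \<comment> \<open>A gain of at least \<open>a * real N / 2\<close> at a rate of at most
    \<open>B\<close> per index takes at least \<open>c * real N\<close> indices.\<close>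
  define c where "c = a / (2 * B)"
  have c: "0 < c" using a B by (simp add: c_def)
  define D where "D n = sum x {..n} - s * real n" for n
  have D: "D n - D m = sum x {m<..n} - s * real (n - m)" if "m \<le> n" for m n
  proof -
    have "sum x {..n} = sum x {..m} + sum x {m<..n}"
      using that by (subst sum.union_disjoint[symmetric]) (auto intro: sum.cong)
    then show ?thesis using that by (simp add: D_def of_nat_diff algebra_simps)
  qed
  have "\<exists>n\<ge>K. \<forall>\<phi>\<in>{1 - c..<1}. s * real (n - nat \<lfloor>\<phi> * real n\<rfloor>) \<le> sum x {nat \<lfloor>\<phi> * real n\<rfloor><..n}"
    for K
  proof -
    have "\<exists>\<^sub>F N in sequentially. s' < Theta \<theta> N x"
    proof (rule ccontr)
      assume "\<not> ?thesis"
      then have "limsup (\<lambda>n. ereal (Theta \<theta> n x)) \<le> ereal s'"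
        by (intro Limsup_bounded) (auto simp: not_frequently not_less)
      with s' show False by simp
    qed
    \<comment> \<open>The bound with \<open>a\<close> lets half of the gain absorb the rounding
      error \<open>\<bar>s\<bar>\<close>; the bound with \<open>c\<close> pushes the maximiser
      beyond \<open>K\<close>.\<close>
    moreover have "eventually (\<lambda>N. 0 < N \<and> 2 * \<bar>s\<bar> / a \<le> real N \<and> real K / c \<le> real N) sequentially"
      using eventually_gt_at_top[of "0::nat"] filterlim_real_sequentially
      by (auto simp: filterlim_at_top intro!: eventually_conj)
    ultimately obtain N where N: "s' < Theta \<theta> N x" "0 < N" "2 * \<bar>s\<bar> / a \<le> real N" "real K / c \<le> real N"
      using frequently_ex[OF frequently_eventually_frequently] by blast
    define m where "m = nat \<lfloor>\<theta> * real N\<rfloor>"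
    have m: "real m \<le> \<theta> * real N" "\<theta> * real N - 1 \<le> real m"
      using \<theta> unfolding m_def by simp linarith
    have "\<theta> * real N \<le> real N" using \<theta> by (simp add: mult_left_le_one_le)
    with m have "m \<le> N" by linarith
    have "Max (D ` {m..N}) \<in> D ` {m..N}"
      using \<open>m \<le> N\<close> by (intro Max_in) auto
    then obtain n where n: "n \<in> {m..N}" and "D n = Max (D ` {m..N})" by auto
    then have nmax: "D k \<le> D n" if "k \<in> {m..N}" for k
      using that by auto
    have "s' * (real N * (1 - \<theta>)) < sum x {m<..N}"
      using N(1,2) \<theta> by (simp add: Theta_eq m_def less_divide_eq)
    \<comment> \<open>Count and length of the window differ by at most 1.\<close>
    moreover have "s * (real (N - m) - real N * (1 - \<theta>)) \<le> \<bar>s\<bar> * 1"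
    proof -
      have "\<bar>real (N - m) - real N * (1 - \<theta>)\<bar> \<le> 1"
        using m \<open>m \<le> N\<close> by (simp add: of_nat_diff algebra_simps abs_le_iff)
      then have "\<bar>s * (real (N - m) - real N * (1 - \<theta>))\<bar> \<le> \<bar>s\<bar> * 1"
        unfolding abs_mult by (rule mult_left_mono) simp
      then show ?thesis by linarith
    qed
    ultimately have "a * real N - \<bar>s\<bar> \<le> D N - D m"
      using D[OF \<open>m \<le> N\<close>] by (simp add: a_def algebra_simps)
    moreover have "2 * \<bar>s\<bar> \<le> a * real N"
      using N(3) a by (simp add: field_simps)
    ultimately have "a * real N / 2 \<le> D n - D m"
      using nmax[of N] \<open>m \<le> N\<close> by simp
    also have "\<dots> \<le> B * real (n - m)"
    proof -
      have "sum x {m<..n} \<le> (\<Sum>i\<in>{m<..n}. M)"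
        using M by (intro sum_mono) (meson abs_le_D1)
      moreover have "- s * real (n - m) \<le> (\<bar>s\<bar> + 1) * real (n - m)"
        by (rule mult_right_mono) auto
      ultimately show ?thesis
        using n D[of m n] by (simp add: B_def algebra_simps)
    qed
    finally have cN: "c * real N \<le> real (n - m)"
      using B by (simp add: c_def field_simps)
    have "real K \<le> c * real N" using N(4) c by (simp add: field_simps)
    with cN have "K \<le> n" by linarith
    moreover have "s * real (n - nat \<lfloor>\<phi> * real n\<rfloor>) \<le> sum x {nat \<lfloor>\<phi> * real n\<rfloor><..n}"
      if \<phi>: "\<phi> \<in> {1 - c..<1}" for \<phi>
    proof -
      \<comment> \<open>Since \<open>n \<le> N\<close>, every window with \<phi> at least 1 - c
        starts at or after \<open>m\<close>, where maximality of \<open>D n\<close> applies.\<close>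
      have "c * real n \<le> c * real N" using n c by simp
      with cN n have "real m \<le> (1 - c) * real n"
        by (simp add: of_nat_diff algebra_simps)
      also have "\<dots> \<le> \<phi> * real n" using \<phi> by (intro mult_right_mono) auto
      finally have "m \<le> nat \<lfloor>\<phi> * real n\<rfloor>" by (simp add: le_nat_floor)
      moreover have "nat \<lfloor>\<phi> * real n\<rfloor> \<le> n"
      proof -
        have "\<phi> * real n \<le> 1 * real n" using \<phi> by (intro mult_right_mono) auto
        then show ?thesis by linarith
      qed
      ultimately show ?thesis
        using nmax[of "nat \<lfloor>\<phi> * real n\<rfloor>"] D[of "nat \<lfloor>\<phi> * real n\<rfloor>" n] n by simp
    qed
    ultimately show ?thesis by blast
  qed
  with c that show ?thesis by blast
qed

text \<open>The good indices \<open>n\<close> do not depend on \<phi>, so one \<open>G\<close>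
  serves all \<phi> near 1 at once.\<close>

lemma free_ultrafilter_with_large_averages:
  assumes \<theta>: "0 < \<theta>" "\<theta> < 1" and M: "\<And>i. \<bar>x i\<bar> \<le> M"
    and s: "ereal s < limsup (\<lambda>n. ereal (Theta \<theta> n x))"
  obtains G where "G \<in> free_ultrafilters"
    and "eventually (\<lambda>\<phi>. s \<le> Lim G (\<lambda>n. Theta \<phi> n x)) (at_left 1)"
proof -
  obtain c where c: "0 < c" and win: "\<forall>K. \<exists>n\<ge>K. \<forall>\<phi>\<in>{1 - c..<1}.
      s * real (n - nat \<lfloor>\<phi> * real n\<rfloor>) \<le> sum x {nat \<lfloor>\<phi> * real n\<rfloor><..n}"
    by (rule windows_with_large_average[OF \<theta> M s])
  obtain G where G: "G \<in> free_ultrafilters" and ev: "eventually (\<lambda>n. \<forall>\<phi>\<in>{1 - c..<1}.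
      s * real (n - nat \<lfloor>\<phi> * real n\<rfloor>) \<le> sum x {nat \<lfloor>\<phi> * real n\<rfloor><..n}) G"
    by (rule ex_free_ultrafilter_frequently[OF win[rule_format]])
  have G': "G \<le> sequentially" "G \<noteq> bot"
    using G by (auto simp: free_ultrafilters_iff ultrafilter_def)
  \<comment> \<open>For negative \<open>s\<close> the bound may hold only in the limit, since the
    ratio of count to length can exceed 1.\<close>
  have "s \<le> Lim G (\<lambda>n. Theta \<phi> n x)" if \<phi>: "0 < \<phi>" "\<phi> < 1" "1 - c \<le> \<phi>" for \<phi>
  proof (rule tendsto_le[OF G'(2) Lim_Theta(2)[OF \<phi>(1,2) M G]])
    show "((\<lambda>n. s * (real (n - nat \<lfloor>\<phi> * real n\<rfloor>) / (real n * (1 - \<phi>)))) \<longlongrightarrow> s) G"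
      using tendsto_mult_left[OF tendsto_mono[OF G'(1) window_card_tendsto[OF \<phi>(1,2)]], of s] by simp
    show "eventually (\<lambda>n. s * (real (n - nat \<lfloor>\<phi> * real n\<rfloor>) / (real n * (1 - \<phi>))) \<le> Theta \<phi> n x) G"
      using ev
    proof eventually_elim
      case (elim n)
      then have "s * real (n - nat \<lfloor>\<phi> * real n\<rfloor>) \<le> sum x {nat \<lfloor>\<phi> * real n\<rfloor><..n}"
        using \<phi> by auto
      then show ?case
        using \<phi> by (auto simp: Theta_eq intro!: divide_right_mono)
    qed
  qed
  moreover have "eventually (\<lambda>\<phi>. 0 < \<phi> \<and> \<phi> < 1 \<and> 1 - c \<le> \<phi>) (at_left (1::real))"
    using c by (auto simp: eventually_at_left_field intro!: exI[of _ "max 0 (1 - c)"])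
  ultimately have "eventually (\<lambda>\<phi>. s \<le> Lim G (\<lambda>n. Theta \<phi> n x)) (at_left 1)"
    by (auto elim: eventually_mono)
  with G that show ?thesis by blast
qed

section \<open>The limit at 1 and the supremum formula\<close>

theorem theorem6p2:
  fixes \<theta> :: "nat \<Rightarrow> real" and x :: "nat \<Rightarrow> real" and F :: "nat filter"
  assumes "\<And>k. \<theta> k \<in> {0<..<1}" and "\<theta> \<longlonglongrightarrow> 1"
    and "bounded (range x)"
    and "F \<in> free_ultrafilters"
  shows "t_func x = (SUP G\<in>free_ultrafilters. Lim F (\<lambda>k. Lim G (\<lambda>n. Theta (\<theta> k) n x)))"
proof -
  obtain M where M: "\<And>i. \<bar>x i\<bar> \<le> M"
    using assms(3) by (auto simp: bounded_iff)
  have \<theta>: "0 < \<theta> k" "\<theta> k < 1" for k using assms(1)[of k] by auto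
  have F: "ultrafilter F" "F \<le> sequentially" "F \<noteq> bot"
    using assms(4) by (auto simp: free_ultrafilters_iff ultrafilter_def)
  define T where "T \<phi> = real_of_ereal (limsup (\<lambda>n. ereal (Theta \<phi> n x)))" for \<phi>
  define t where "t = (SUP \<phi>\<in>{0<..<1}. T \<phi>)"
  have unit: "eventually (\<lambda>\<phi>. \<phi> \<in> {0<..<1}) (at_left (1::real))"
    by (rule eventually_at_left_real) simp
  have bdd: "bdd_above (T ` {0<..<1})"
    using limsup_Theta(2)[where x = x, OF _ _ M] by (intro bdd_aboveI[of _ "2 * M"]) (auto simp: T_def)
  have T_le: "T \<phi> \<le> t" if "\<phi> \<in> {0<..<1}" for \<phi>
    unfolding t_def using that bdd by (rule cSUP_upper)
  \<comment> \<open>This fact serves twice: for the convergence of \<open>T\<close> to its supremum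
    and for the lower bound in the formula.\<close>
  have large: "\<exists>G\<in>free_ultrafilters. eventually (\<lambda>\<phi>. s \<le> Lim G (\<lambda>n. Theta \<phi> n x)) (at_left 1)"
    if "s < t" for s
  proof -
    obtain \<phi> where \<phi>: "\<phi> \<in> {0<..<1}" "s < T \<phi>"
      using \<open>s < t\<close> bdd by (auto simp: t_def less_cSUP_iff)
    then have "ereal s < limsup (\<lambda>n. ereal (Theta \<phi> n x))"
      by (subst limsup_Theta(1)[OF _ _ M]) (auto simp: T_def)
    with \<phi>(1) obtain G where "G \<in> free_ultrafilters"
      "eventually (\<lambda>\<phi>. s \<le> Lim G (\<lambda>n. Theta \<phi> n x)) (at_left 1)"
      by (auto intro: free_ultrafilter_with_large_averages[OF _ _ M])
    then show ?thesis by blast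
  qed
  have T_lim: "(T \<longlongrightarrow> t) (at_left 1)"
  proof (rule order_tendstoI)
    fix s assume "s < t"
    then obtain s' where s': "s < s'" "s' < t" using dense by blast
    from large[OF s'(2)] obtain G where G: "G \<in> free_ultrafilters"
      and ev: "eventually (\<lambda>\<phi>. s' \<le> Lim G (\<lambda>n. Theta \<phi> n x)) (at_left 1)" by blast
    \<comment> \<open>\<open>T \<phi>\<close> dominates the limit along \<open>G\<close>, which is
      at least \<open>s'\<close> near 1.\<close>
    from unit ev show "eventually (\<lambda>\<phi>. s < T \<phi>) (at_left 1)"
    proof eventually_elim
      case (elim \<phi>)
      then show ?case
        using Lim_Theta(1)[of \<phi> x M G, OF _ _ M G] s'(1) by (auto simp: T_def)
    qed
  next
    fix s assume "t < s"
    with T_le show "eventually (\<lambda>\<phi>. T \<phi> < s) (at_left 1)"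
      by (intro eventually_mono[OF unit]) (auto intro: le_less_trans)
  qed
  have t_func: "t_func x = t"
    unfolding t_func_def T_def[symmetric] by (rule tendsto_Lim[OF _ T_lim]) simp
  \<comment> \<open>\<open>F\<close> refines \<open>sequentially\<close>, so whatever holds for all
    \<phi> near 1 on the left holds for \<open>\<theta> k\<close> along \<open>F\<close>.\<close>
  have \<theta>_lim: "filterlim \<theta> (at_left 1) F"
    using assms(2) \<theta> F(2) by (auto simp: filterlim_at tendsto_mono less_imp_neq)
  have FG_lim: "((\<lambda>k. Lim G (\<lambda>n. Theta (\<theta> k) n x)) \<longlongrightarrow> Lim F (\<lambda>k. Lim G (\<lambda>n. Theta (\<theta> k) n x))) F"
    if "G \<in> free_ultrafilters" for G
    using Lim_Theta(3)[OF \<theta> M that]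
    by (intro ultrafilter_Lim_bounded(1)[OF F(1)] always_eventually allI)
  have upper: "Lim F (\<lambda>k. Lim G (\<lambda>n. Theta (\<theta> k) n x)) \<le> t" if G: "G \<in> free_ultrafilters" for G
  proof (rule tendsto_upperbound[OF FG_lim[OF G] _ F(3)])
    have "Lim G (\<lambda>n. Theta (\<theta> k) n x) \<le> t" for k
      using Lim_Theta(1)[of "\<theta> k" x M G, OF \<theta> M G] T_le[of "\<theta> k"] \<theta>[of k] by (simp add: T_def)
    then show "eventually (\<lambda>k. Lim G (\<lambda>n. Theta (\<theta> k) n x) \<le> t) F" by simp
  qed
  show ?thesis
    unfolding t_func
  proof (rule antisym)
    show "(SUP G\<in>free_ultrafilters. Lim F (\<lambda>k. Lim G (\<lambda>n. Theta (\<theta> k) n x))) \<le> t"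
      using assms(4) upper by (intro cSUP_least) auto
    show "t \<le> (SUP G\<in>free_ultrafilters. Lim F (\<lambda>k. Lim G (\<lambda>n. Theta (\<theta> k) n x)))"
    \<comment> \<open>The ultrafilter \<open>G\<close> depends on \<open>s\<close>, hence the
      approximation of \<open>t\<close> from below.\<close>
    proof (rule dense_le)
      fix s assume "s < t"
      from large[OF this] obtain G where G: "G \<in> free_ultrafilters"
        and "eventually (\<lambda>\<phi>. s \<le> Lim G (\<lambda>n. Theta \<phi> n x)) (at_left 1)" by blast
      then have "eventually (\<lambda>k. s \<le> Lim G (\<lambda>n. Theta (\<theta> k) n x)) F"
        using \<theta>_lim by (auto simp: filterlim_iff)
      then have "s \<le> Lim F (\<lambda>k. Lim G (\<lambda>n. Theta (\<theta> k) n x))"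
        by (rule tendsto_lowerbound[OF FG_lim[OF G] _ F(3)])
      also have "\<dots> \<le> (SUP G\<in>free_ultrafilters. Lim F (\<lambda>k. Lim G (\<lambda>n. Theta (\<theta> k) n x)))"
        using upper G by (intro cSUP_upper bdd_aboveI[of _ t]) auto
      finally show "s \<le> (SUP G\<in>free_ultrafilters. Lim F (\<lambda>k. Lim G (\<lambda>n. Theta (\<theta> k) n x)))" .
    qed
  qed
qed

end
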